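(* Let $\mathcal{L}=\langle P,\{\stackrel{a}{\longrightarrow}\}_{a\in L}\rangle$ be a PLTS, $\rho:\mathit{Var}\to[0,1]^P$ an interpretation of the variables, and $F$ a pL$\mu^\odot$ formula. Let $\mathbb{P}_{>0}F$ denote the formula $\mu X.(F\odot X)$ and $\mathbb{P}_{=1}F$ the formula $\nu X.(F\cdot X)$, where $X$ is a variable not free in $F$. Then for every state $p\in P$: $$[\![\mathbb{P}_{>0}F]\!]_\rho(p)=\begin{cases}1&\text{if }[\![F]\!]_\rho(p)>0\\0&\text{otherwise}\end{cases}\qquad\text{and}\qquad[\![\mathbb{P}_{=1}F]\!]_\rho(p)=\begin{cases}1&\text{if }[\![F]\!]_\rho(p)=1\\0&\text{otherwise.}\end{cases}$$
   Context: $\mathcal{D}(X)$ is the set of functions $d:X\to[0,1]$ with $\sum_xd(x)=1$. For a countable set $L$ of labels, a PLTS is $\langle P,\{\stackrel{a}{\longrightarrow}\}_{a\in L}\rangle$ with $P$ countable and ${\stackrel{a}{\longrightarrow}}\subseteq P\times\mathcal{D}(P)$ such that $\{d:p\stackrel{a}{\longrightarrow}d\}$ is countable for all $p,a$. pL$\mu^\odot$ formulas: $F,G::=X\mid F\wedge G\mid F\vee G\mid F\cdot G\mid F\odot G\mid[a]F\mid\langle a\rangle F\mid\nu X.F\mid\mu X.F$, with $X\in\mathit{Var}$ (a set of variables) and $a\in L$. On $[0,1]$, $x\odot y=1-(1-x)(1-y)$. For $\rho:\mathit{Var}\to[0,1]^P$, $[\![F]\!]_\rho:P\to[0,1]$ is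 defined by $[\![X]\!]_\rho=\rho(X)$; $\vee,\wedge,\cdot,\odot$ are interpreted pointwise as $\max$, $\min$, multiplication, $\odot$; $[\![\langle a\rangle G]\!]_\rho(p)=\sup_{p\stackrel{a}{\to}d}\sum_qd(q)[\![G]\!]_\rho(q)$; $[\![[a]G]\!]_\rho(p)=\inf_{p\stackrel{a}{\to}d}\sum_qd(q)[\![G]\!]_\rho(q)$ (sup and inf in $[0,1]$, so $\sup\emptyset=0$, $\inf\emptyset=1$); $[\![\mu X.G]\!]_\rho$ and $[\![\nu X.G]\!]_\rho$ are the least and greatest fixed points of the monotone map $f\mapsto[\![G]\!]_{\rho[f/X]}$ on the complete lattice $[0,1]^P$ with pointwise order. *)

theory Defs
  imports "HOL-Probability.Probability_Mass_Function"
begin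

section \<open>The unit interval as a complete lattice\<close>

typedef unit_interval = "{0..1::real}"
  morphisms real_of_ui ui_of_real
  by (rule exI[of _ 0]) simp

setup_lifting type_definition_unit_interval

lemma real_of_ui_bounds: "0 \<le> real_of_ui x" "real_of_ui x \<le> 1"
  using real_of_ui[of x] by auto

instantiation unit_interval :: zero_neq_one
begin
lift_definition zero_unit_interval :: unit_interval is 0 by simp
lift_definition one_unit_interval :: unit_interval is 1 by simp
instance by standard (transfer, simp)
end

instantiation unit_interval :: times
begin
lift_definition times_unit_interval :: "unit_interval \<Rightarrow> unit_interval \<Rightarrow> unit_interval"
  is "\<lambda>x y. x * y" by (auto intro: mult_le_one)
instance ..
end

lift_definition coprod :: "unit_interval \<Rightarrow> unit_interval \<Rightarrow> unit_interval"  (infixl \<open>\<odot>\<close> 70)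
  is "\<lambda>x y. 1 - (1 - x) * (1 - y)"
  by (auto intro: mult_le_one)

instantiation unit_interval :: linorder
begin
lift_definition less_eq_unit_interval :: "unit_interval \<Rightarrow> unit_interval \<Rightarrow> bool" is "(\<le>)" .
lift_definition less_unit_interval :: "unit_interval \<Rightarrow> unit_interval \<Rightarrow> bool" is "(<)" .
instance by standard (transfer, auto)+
end

text \<open>Infima and suprema are those of \<open>[0,1]\<close>, so the empty set has infimum \<open>1\<close> and supremum \<open>0\<close>.\<close>

instantiation unit_interval :: complete_linorder
begin

definition inf_unit_interval :: "unit_interval \<Rightarrow> unit_interval \<Rightarrow> unit_interval"
  where "inf_unit_interval = min"
definition sup_unit_interval :: "unit_interval \<Rightarrow> unit_interval \<Rightarrow> unit_interval"
  where "sup_unit_interval = max"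
definition bot_unit_interval :: unit_interval where "bot_unit_interval = 0"
definition top_unit_interval :: unit_interval where "top_unit_interval = 1"
definition Inf_unit_interval :: "unit_interval set \<Rightarrow> unit_interval"
  where "Inf_unit_interval A = (if A = {} then 1 else ui_of_real (Inf (real_of_ui ` A)))"
definition Sup_unit_interval :: "unit_interval set \<Rightarrow> unit_interval"
  where "Sup_unit_interval A = (if A = {} then 0 else ui_of_real (Sup (real_of_ui ` A)))"

lemma real_of_ui_Inf: "A \<noteq> {} \<Longrightarrow> real_of_ui (Inf A) = Inf (real_of_ui ` A)"
  unfolding Inf_unit_interval_def
  by (auto intro!: ui_of_real_inverse cInf_greatest real_of_ui_bounds
      cInf_lower2[OF imageI] bdd_belowI2[of _ 0])

lemma real_of_ui_Sup: "A \<noteq> {} \<Longrightarrow> real_of_ui (Sup A) = Sup (real_of_ui ` A)"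
  unfolding Sup_unit_interval_def
  by (auto intro!: ui_of_real_inverse cSup_least real_of_ui_bounds
      cSup_upper2[OF imageI] bdd_aboveI2[of _ _ 1])

instance
proof
  fix x y z :: unit_interval and A :: "unit_interval set"
  show "inf x y \<le> x" "inf x y \<le> y" "x \<le> y \<Longrightarrow> x \<le> z \<Longrightarrow> x \<le> inf y z"
    by (auto simp: inf_unit_interval_def)
  show "x \<le> sup x y" "y \<le> sup x y" "y \<le> x \<Longrightarrow> z \<le> x \<Longrightarrow> sup y z \<le> x"
    by (auto simp: sup_unit_interval_def)
  show "x \<in> A \<Longrightarrow> Inf A \<le> x"
    by (subst less_eq_unit_interval.rep_eq, subst real_of_ui_Inf)
       (auto intro!: cInf_lower bdd_belowI2[of _ 0] real_of_ui_bounds)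
  show "x \<in> A \<Longrightarrow> x \<le> Sup A"
    by (subst less_eq_unit_interval.rep_eq, subst real_of_ui_Sup)
       (auto intro!: cSup_upper bdd_aboveI2[of _ _ 1] real_of_ui_bounds)
  show "z \<le> Inf A" if "\<And>x. x \<in> A \<Longrightarrow> z \<le> x"
  proof (cases "A = {}")
    case True
    then show ?thesis
      by (simp add: Inf_unit_interval_def less_eq_unit_interval.rep_eq one_unit_interval.rep_eq
          real_of_ui_bounds)
  next
    case False
    with that show ?thesis
      by (auto simp: less_eq_unit_interval.rep_eq real_of_ui_Inf intro!: cInf_greatest)
  qed
  show "Sup A \<le> z" if "\<And>x. x \<in> A \<Longrightarrow> x \<le> z"
  proof (cases "A = {}")
    case True
    then show ?thesis
      by (simp add: Sup_unit_interval_def less_eq_unit_interval.rep_eq zero_unit_interval.rep_eq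
          real_of_ui_bounds)
  next
    case False
    with that show ?thesis
      by (auto simp: less_eq_unit_interval.rep_eq real_of_ui_Sup intro!: cSup_least)
  qed
  show "Inf ({} :: unit_interval set) = top" "Sup ({} :: unit_interval set) = bot"
    by (simp_all add: Inf_unit_interval_def Sup_unit_interval_def
        top_unit_interval_def bot_unit_interval_def)
qed

end

section \<open>Probabilistic labelled transition systems\<close>

text \<open>
  The countable sets of states and labels are types of class \<open>countable\<close>. On such a state type,
  \<open>'s pmf\<close> is the type of functions \<open>d\<close> into \<open>[0,1]\<close> with \<open>(\<Sum>x. d x) = 1\<close>.
\<close>

type_synonym ('l, 's) transitions = "'l \<Rightarrow> ('s \<times> 's pmf) set"

locale plts =
  fixes T :: "('l::countable, 's::countable) transitions"
  assumes countable_successors: "countable {d. (p, d) \<in> T a}"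

section \<open>Formulas and their semantics\<close>

datatype ('v, 'l) formula =
    Var 'v
  | Conj "('v, 'l) formula" "('v, 'l) formula"
  | Disj "('v, 'l) formula" "('v, 'l) formula"
  | Prod "('v, 'l) formula" "('v, 'l) formula"
  | Coprod "('v, 'l) formula" "('v, 'l) formula"
  | Box 'l "('v, 'l) formula"
  | Diamond 'l "('v, 'l) formula"
  | Nu 'v "('v, 'l) formula"
  | Mu 'v "('v, 'l) formula"

primrec free_vars :: "('v, 'l) formula \<Rightarrow> 'v set" where
  "free_vars (Var X) = {X}"
| "free_vars (Conj F G) = free_vars F \<union> free_vars G"
| "free_vars (Disj F G) = free_vars F \<union> free_vars G"
| "free_vars (Prod F G) = free_vars F \<union> free_vars G"
| "free_vars (Coprod F G) = free_vars F \<union> free_vars G"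
| "free_vars (Box a F) = free_vars F"
| "free_vars (Diamond a F) = free_vars F"
| "free_vars (Nu X F) = free_vars F - {X}"
| "free_vars (Mu X F) = free_vars F - {X}"

definition expect :: "'s pmf \<Rightarrow> ('s \<Rightarrow> unit_interval) \<Rightarrow> unit_interval" where
  "expect d f = ui_of_real (\<Sum>\<^sub>\<infinity>q. pmf d q * real_of_ui (f q))"

primrec sem :: "('l, 's) transitions \<Rightarrow> ('v, 'l) formula \<Rightarrow> ('v \<Rightarrow> 's \<Rightarrow> unit_interval)
    \<Rightarrow> 's \<Rightarrow> unit_interval" where
  "sem T (Var X) \<rho> = \<rho> X"
| "sem T (Conj F G) \<rho> = (\<lambda>p. min (sem T F \<rho> p) (sem T G \<rho> p))"
| "sem T (Disj F G) \<rho> = (\<lambda>p. max (sem T F \<rho> p) (sem T G \<rho> p))"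
| "sem T (Prod F G) \<rho> = (\<lambda>p. sem T F \<rho> p * sem T G \<rho> p)"
| "sem T (Coprod F G) \<rho> = (\<lambda>p. sem T F \<rho> p \<odot> sem T G \<rho> p)"
| "sem T (Box a G) \<rho> = (\<lambda>p. INF d\<in>{d. (p, d) \<in> T a}. expect d (sem T G \<rho>))"
| "sem T (Diamond a G) \<rho> = (\<lambda>p. SUP d\<in>{d. (p, d) \<in> T a}. expect d (sem T G \<rho>))"
| "sem T (Nu X G) \<rho> = gfp (\<lambda>f. sem T G (\<rho>(X := f)))"
| "sem T (Mu X G) \<rho> = lfp (\<lambda>f. sem T G (\<rho>(X := f)))"

subsection \<open>Well-definedness\<close>

text \<open>
  The sum in \<^const>\<open>expect\<close> converges to a value in \<open>[0,1]\<close>, and the maps in the fixed point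
  clauses are monotone, so that \<^const>\<open>lfp\<close> and \<^const>\<open>gfp\<close> are indeed their least and greatest
  fixed points.
\<close>

lemma expect_summable:
  "(\<lambda>q. pmf d q * real_of_ui (f q)) summable_on UNIV"
  "(\<lambda>q. pmf d q) summable_on UNIV"
proof -
  show *: "(\<lambda>q. pmf d q) summable_on UNIV"
    using pmf_abs_summable[of d UNIV] abs_summable_equivalent abs_summable_summable by blast
  show "(\<lambda>q. pmf d q * real_of_ui (f q)) summable_on UNIV"
    by (rule summable_on_comparison_test[OF *])
       (auto simp: real_of_ui_bounds intro: mult_left_le)
qed

lemma infsum_pmf: "(\<Sum>\<^sub>\<infinity>q. pmf d q) = 1"
  using infsetsum_infsum[OF pmf_abs_summable[of d UNIV]] infsetsum_pmf_eq_1[of d UNIV] by simp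

lemma real_of_ui_expect:
  "real_of_ui (expect d f) = (\<Sum>\<^sub>\<infinity>q. pmf d q * real_of_ui (f q))"
proof -
  have "(\<Sum>\<^sub>\<infinity>q. pmf d q * real_of_ui (f q)) \<le> (\<Sum>\<^sub>\<infinity>q. pmf d q)"
    by (intro infsum_mono expect_summable) (auto simp: real_of_ui_bounds intro: mult_left_le)
  moreover have "0 \<le> (\<Sum>\<^sub>\<infinity>q. pmf d q * real_of_ui (f q))"
    by (intro infsum_nonneg) (simp add: real_of_ui_bounds)
  ultimately show ?thesis
    by (simp add: expect_def ui_of_real_inverse infsum_pmf)
qed

lemma expect_mono: "f \<le> g \<Longrightarrow> expect d f \<le> expect d g"
  unfolding less_eq_unit_interval.rep_eq real_of_ui_expect
  by (intro infsum_mono expect_summable mult_left_mono)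
     (auto simp: le_fun_def less_eq_unit_interval.rep_eq)

lemma times_ui_mono: "a \<le> b \<Longrightarrow> c \<le> d \<Longrightarrow> a * c \<le> b * (d :: unit_interval)"
  by transfer (auto intro: mult_mono)

lemma coprod_mono: "a \<le> b \<Longrightarrow> c \<le> d \<Longrightarrow> a \<odot> c \<le> b \<odot> d"
  by transfer (auto intro: mult_mono)

lemma sem_mono: "\<rho> \<le> \<sigma> \<Longrightarrow> sem T F \<rho> \<le> sem T F \<sigma>"
proof (induction F arbitrary: \<rho> \<sigma>)
  case (Var X) then show ?case by (simp add: le_fun_def)
next
  case (Conj F G)
  from Conj.IH[OF Conj.prems] show ?case by (auto simp: le_fun_def intro: min.coboundedI1 min.coboundedI2)
next
  case (Disj F G)
  from Disj.IH[OF Disj.prems] show ?case by (auto simp: le_fun_def intro: max.coboundedI1 max.coboundedI2)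
next
  case (Prod F G)
  from Prod.IH[OF Prod.prems] show ?case by (auto simp: le_fun_def intro!: times_ui_mono)
next
  case (Coprod F G)
  from Coprod.IH[OF Coprod.prems] show ?case by (auto simp: le_fun_def intro!: coprod_mono)
next
  case (Box a G)
  from Box.IH[OF Box.prems] show ?case
    by (subst le_fun_def) (auto intro!: INF_mono' expect_mono)
next
  case (Diamond a G)
  from Diamond.IH[OF Diamond.prems] show ?case
    by (subst le_fun_def) (auto intro!: SUP_mono' expect_mono)
next
  case (Nu X G)
  then show ?case by (simp, intro gfp_mono) (auto simp: le_fun_def)
next
  case (Mu X G)
  then show ?case by (simp, intro lfp_mono) (auto simp: le_fun_def)
qed

lemma mono_sem_update: "mono (\<lambda>f. sem T G (\<rho>(X := f)))"
  by (intro monoI sem_mono) (simp add: le_fun_def)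

section \<open>The threshold modalities\<close>

text \<open>Used only with a variable \<open>X\<close> that is not free in \<open>F\<close>.\<close>

definition P_pos :: "'v \<Rightarrow> ('v, 'l) formula \<Rightarrow> ('v, 'l) formula" where
  "P_pos X F = Mu X (Coprod F (Var X))"

definition P_one :: "'v \<Rightarrow> ('v, 'l) formula \<Rightarrow> ('v, 'l) formula" where
  "P_one X F = Nu X (Prod F (Var X))"

end

theory Submission imports Defs begin

text \<open>
  As \<open>X\<close> is not free in \<open>F\<close>, both formulas are fixed points of a pointwise map with the constant
  coefficient \<open>a = \<lbrakk>F\<rbrakk>\<close>. A fixed point \<open>r = a \<odot> r\<close> satisfies \<open>a = 0\<close> or \<open>r = 1\<close>, and a fixed point
  \<open>r = a \<cdot> r\<close> satisfies \<open>a = 1\<close> or \<open>r = 0\<close>; the remaining values are forced by leastness and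
  greatestness, because the claimed \<open>{0,1}\<close>-valued functions are themselves fixed points.
\<close>

text \<open>Lets the value of \<open>F\<close> stay constant while the fixed point iteration varies
  the valuation at a variable not free in \<open>F\<close>.\<close>

lemma sem_cong:
  "(\<And>X. X \<in> free_vars F \<Longrightarrow> \<rho> X = \<sigma> X) \<Longrightarrow> sem T F \<rho> = sem T F \<sigma>"
proof (induction F arbitrary: \<rho> \<sigma>)
  case (Conj F G)
  from Conj.prems show ?case
    by (simp add: Conj.IH(1)[of \<rho> \<sigma>] Conj.IH(2)[of \<rho> \<sigma>])
next
  case (Disj F G)
  from Disj.prems show ?case
    by (simp add: Disj.IH(1)[of \<rho> \<sigma>] Disj.IH(2)[of \<rho> \<sigma>])
next
  case (Prod F G)
  from Prod.prems show ?case
    by (simp add: Prod.IH(1)[of \<rho> \<sigma>] Prod.IH(2)[of \<rho> \<sigma>])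
next
  case (Coprod F G)
  from Coprod.prems show ?case
    by (simp add: Coprod.IH(1)[of \<rho> \<sigma>] Coprod.IH(2)[of \<rho> \<sigma>])
next
  case (Box a G)
  from Box.prems show ?case
    by (simp add: Box.IH[of \<rho> \<sigma>])
next
  case (Diamond a G)
  from Diamond.prems show ?case
    by (simp add: Diamond.IH[of \<rho> \<sigma>])
next
  case (Nu X G)
  \<comment> \<open>The bound variable \<open>X\<close> may be free in \<open>G\<close>, but there
    both updated valuations take the value \<open>f\<close>.\<close>
  have "sem T G (\<rho>(X := f)) = sem T G (\<sigma>(X := f))" for f
    by (rule Nu.IH) (simp add: Nu.prems)
  then show ?case by simp
next
  case (Mu X G)
  have "sem T G (\<rho>(X := f)) = sem T G (\<sigma>(X := f))" for f
    by (rule Mu.IH) (simp add: Mu.prems)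
  then show ?case by simp
qed simp

lemma coprod_eq_right_iff: "a \<odot> r = r \<longleftrightarrow> a = 0 \<or> r = 1"
proof transfer
  fix a r :: real
  \<comment> \<open>The defect of the fixed point equation factors, so it vanishes iff one factor
    does.\<close>
  have "1 - (1 - a) * (1 - r) - r = a * (1 - r)" by (simp add: algebra_simps)
  then show "1 - (1 - a) * (1 - r) = r \<longleftrightarrow> a = 0 \<or> r = 1" by auto
qed

lemma times_ui_eq_right_iff: "a * r = r \<longleftrightarrow> a = 1 \<or> r = (0 :: unit_interval)"
  by transfer auto

lemma ui_bounds: "0 \<le> (x :: unit_interval)" "x \<le> 1"
  by (transfer, simp)+

lemma lfp_coprod:
  "lfp (\<lambda>f p. a p \<odot> f p) = (\<lambda>p. if a p > 0 then 1 else 0)" (is "lfp ?\<Phi> = ?g")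
proof (rule antisym)
  have pos: "\<not> a p > 0 \<longleftrightarrow> a p = 0" for p
    using ui_bounds(1)[of "a p"] by auto
  \<comment> \<open>Where \<open>a p > 0\<close>, the value 1 is absorbing for \<odot>; elsewhere
    \<open>a p = 0\<close> is its unit.\<close>
  then have "?\<Phi> ?g = ?g"
    by (auto simp: fun_eq_iff coprod_eq_right_iff)
  then show "lfp ?\<Phi> \<le> ?g" by (simp add: lfp_lowerbound)
  have "mono ?\<Phi>"
    by (auto intro!: monoI coprod_mono simp: le_fun_def)
  then have "a p \<odot> lfp ?\<Phi> p = lfp ?\<Phi> p" for p
    using lfp_unfold[of ?\<Phi>] by (metis (mono_tags, lifting))
  then have "a p = 0 \<or> lfp ?\<Phi> p = 1" for p
    by (simp add: coprod_eq_right_iff)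
  then show "?g \<le> lfp ?\<Phi>"
    by (auto simp: le_fun_def ui_bounds) (metis less_irrefl order_refl)
qed

lemma gfp_times:
  fixes a :: "'s \<Rightarrow> unit_interval"
  shows "gfp (\<lambda>f p. a p * f p) = (\<lambda>p. if a p = 1 then 1 else 0)" (is "gfp ?\<Phi> = ?g")
proof (rule antisym)
  have "?\<Phi> ?g = ?g"
    by (auto simp: fun_eq_iff times_ui_eq_right_iff)
  then show "?g \<le> gfp ?\<Phi>" by (simp add: gfp_upperbound)
  have "mono ?\<Phi>"
    by (auto intro!: monoI times_ui_mono simp: le_fun_def)
  then have "a p * gfp ?\<Phi> p = gfp ?\<Phi> p" for p
    using gfp_unfold[of ?\<Phi>] by (metis (mono_tags, lifting))
  then have "a p = 1 \<or> gfp ?\<Phi> p = 0" for p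
    by (simp add: times_ui_eq_right_iff)
  \<comment> \<open>Only states with \<open>a p \<noteq> 1\<close> matter, since elsewhere
    \<open>?g\<close> is the top value 1.\<close>
  then show "gfp ?\<Phi> \<le> ?g"
    by (auto simp: le_fun_def ui_bounds) (metis order_refl)
qed

theorem lemma3p4:
  fixes T :: "('l::countable, 's::countable) transitions"
    and \<rho> :: "'v \<Rightarrow> 's \<Rightarrow> unit_interval"
    and F :: "('v, 'l) formula"
    and X :: 'v
  assumes "plts T" and "X \<notin> free_vars F"
  shows "\<forall>p. sem T (P_pos X F) \<rho> p = (if sem T F \<rho> p > 0 then 1 else 0) \<and>
             sem T (P_one X F) \<rho> p = (if sem T F \<rho> p = 1 then 1 else 0)"
proof -
  \<comment> \<open>Turns both fixed point bodies into pointwise maps with coefficient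
    \<open>sem T F \<rho>\<close>.\<close>
  have "sem T F (\<rho>(X := f)) = sem T F \<rho>" for f
    using assms(2) by (intro sem_cong) auto
  then show ?thesis
    by (simp add: P_pos_def P_one_def lfp_coprod gfp_times)
qed

end
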